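(* Consider the partially observed Gauss--Markov model described in the context, and assume that the measurement covariance matrices $R_1,\dots,R_T$ are positive definite. Then for every $t\in\{1,\dots,T\}$ the following hold. (i) There exist a matrix $\Phi^{t:T}_{t,t-1}\in\mathbb{R}^{n\times n}$, a vector $u^{t:T}_{t,t-1}\in\mathbb{R}^n$ and a symmetric positive semidefinite matrix $Q^{t:T}_{t,t-1}\in\mathbb{R}^{n\times n}$ such that, for every $z\in\mathbb{R}^n$, $$\pi^{t:T}_{t\mid t-1}(\cdot\mid z)=\mathcal{N}\big(\mu^{t:T}_{t\mid t-1}(z),\,Q^{t:T}_{t,t-1}\big),\qquad \mu^{t:T}_{t\mid t-1}(z)=\Phi^{t:T}_{t,t-1}z+u^{t:T}_{t,t-1}.$$ (ii) For each $s\in\{t-1,t\}$ there exist an integer $\bar m_{t:T\mid s}$ with $m\le \bar m_{t:T\mid s}\le n$, a constant $c_{t:T\mid s}>0$, a vector $\bar y_{t:T\mid s}\in\mathbb{R}^{\bar m_{t:T\mid s}}$ and a matrix $\bar C_{t:T\mid s}\in\mathbb{R}^{\bar m_{t:T\mid s}\times n}$ such that, for every $x\in\mathbb{R}^n$, $$h_{t:T\mid s}(x)=c_{t:T\mid s}\exp\Big[-\tfrac12\big|\bar y_{t:T\mid s}-\bar C_{t:T\mid s}x\big|^2\Big].$$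
   Context: Model. Let $1\le m\le n$ and $T\ge 1$ be integers. The states $x_0,\dots,x_T$ take values in $\mathbb{R}^n$ and the measurements $y_1,\dots,y_T$ in $\mathbb{R}^m$, with $$x_0\sim\mathcal{N}(\mu_0,\Sigma_0),\qquad x_t\mid x_{t-1}\sim\pi_{t\mid t-1}(\cdot\mid x_{t-1})=\mathcal{N}(\Phi_{t,t-1}x_{t-1}+u_{t,t-1},\,Q_{t,t-1}),\qquad y_t\mid x_t\sim\mathcal{N}(C_tx_t,R_t),$$ for $t=1,\dots,T$, where $\Phi_{t,t-1}\in\mathbb{R}^{n\times n}$, $u_{t,t-1}\in\mathbb{R}^n$, $C_t\in\mathbb{R}^{m\times n}$, and $\Sigma_0,Q_{t,t-1}\in\mathbb{R}^{n\times n}$, $R_t\in\mathbb{R}^{m\times m}$ are symmetric positive semidefinite. $\mathcal{N}(\mu,\Sigma)$ is the Gaussian distribution with mean $\mu$ and covariance $\Sigma$ (possibly degenerate). $\Phi_{t,t-1}$ and $Q_{t,t-1}$ need not be invertible. $|\cdot|$ is the Euclidean norm. Likelihoods. The measurement sequence $y_1,\dots,y_T$ is fixed and omitted from the notation. $h_{t\mid t}(x)$ is the density of $\mathcal{N}(C_tx,R_t)$ evaluated at $y_t$. For $s\in\{t-1,t\}$, $h_{t:T\mid s}(x)$ is the conditional density of $y_{t:T}=(y_t,\dots,y_T)$ given $x_s=x$, evaluated at the fixed measurements; it is determined by $h_{T:T\mid T}=h_{T\mid T}$ and $$h_{t:T\mid t-1}(z)=\int h_{t:T\mid t}(x)\,\pi_{t\mid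 t-1}(\mathrm{d}x\mid z)\ \ (1\le t\le T),\qquad h_{t-1:T\mid t-1}(x)=h_{t-1\mid t-1}(x)\,h_{t:T\mid t-1}(x)\ \ (2\le t\le T).$$ Posterior transitions. $\pi^{t:T}_{t\mid t-1}(\cdot\mid z)$ is the conditional distribution of $x_t$ given $x_{t-1}=z$ and $y_{t:T}$, i.e. $$\pi^{t:T}_{t\mid t-1}(\mathrm{d}x\mid z)=\frac{h_{t:T\mid t}(x)\,\pi_{t\mid t-1}(\mathrm{d}x\mid z)}{h_{t:T\mid t-1}(z)}.$$ *)

theory Defs
  imports "HOL-Probability.Probability"
begin

definition psd_matrix :: "real^'n^'n \<Rightarrow> bool" where
  "psd_matrix A \<longleftrightarrow> transpose A = A \<and> (\<forall>x. 0 \<le> x \<bullet> (A *v x))"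

definition pd_matrix :: "real^'n^'n \<Rightarrow> bool" where
  "pd_matrix A \<longleftrightarrow> transpose A = A \<and> (\<forall>x. x \<noteq> 0 \<longrightarrow> 0 < x \<bullet> (A *v x))"

definition std_gaussian :: "(real^'n) measure" where
  "std_gaussian = density lborel (\<lambda>x. ennreal (\<Prod>i\<in>UNIV. std_normal_density (x $ i)))"

text \<open>
  The possibly degenerate Gaussian distribution with mean \<open>\<mu>\<close> and covariance \<open>\<Sigma>\<close> is the law of
  \<open>\<mu> + A Z\<close> with \<open>Z\<close> standard Gaussian and \<open>A A\<^sup>T = \<Sigma>\<close>. Such an \<open>A\<close> exists
  if and only if \<open>\<Sigma>\<close> is symmetric positive semidefinite; the law does not depend on its choice,
  because the standard Gaussian is invariant under orthogonal maps. For other \<open>\<Sigma>\<close> the value is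
  meaningless.
\<close>
definition gaussian :: "real^'n \<Rightarrow> real^'n^'n \<Rightarrow> (real^'n) measure" where
  "gaussian \<mu> \<Sigma> =
     distr std_gaussian borel (\<lambda>z. \<mu> + (SOME A :: real^'n^'n. A ** transpose A = \<Sigma>) *v z)"

text \<open>Lebesgue density of \<open>gaussian \<mu> \<Sigma>\<close>, for positive definite \<open>\<Sigma>\<close> only.\<close>
definition gaussian_density :: "real^'n \<Rightarrow> real^'n^'n \<Rightarrow> real^'n \<Rightarrow> real" where
  "gaussian_density \<mu> \<Sigma> y =
     exp (- ((y - \<mu>) \<bullet> (matrix_inv \<Sigma> *v (y - \<mu>))) / 2) / sqrt ((2 * pi) ^ CARD('n) * det \<Sigma>)"

text \<open>
  States live in \<open>real^'n\<close>, measurements in \<open>real^'m\<close>. The functions of time are relevant at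
  \<open>t \<in> {1..horizon M}\<close> only; \<open>trans_mat M t\<close>, \<open>trans_shift M t\<close> and \<open>trans_cov M t\<close> describe the
  transition from time \<open>t - 1\<close> to time \<open>t\<close>.
\<close>
record ('n::finite, 'm::finite) gm_model =
  horizon :: nat
  init_mean :: "real^'n"
  init_cov :: "real^'n^'n"
  trans_mat :: "nat \<Rightarrow> real^'n^'n"
  trans_shift :: "nat \<Rightarrow> real^'n"
  trans_cov :: "nat \<Rightarrow> real^'n^'n"
  meas_mat :: "nat \<Rightarrow> real^'n^'m"
  meas_cov :: "nat \<Rightarrow> real^'m^'m"

definition gauss_markov :: "('n::finite, 'm::finite) gm_model \<Rightarrow> bool" where
  "gauss_markov M \<longleftrightarrow>
     CARD('m) \<le> CARD('n) \<and> 1 \<le> horizon M \<and> psd_matrix (init_cov M) \<and>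
     (\<forall>t\<in>{1..horizon M}. psd_matrix (trans_cov M t) \<and> psd_matrix (meas_cov M t))"

text \<open>The prior transition \<open>\<pi>\<^bsub>t|t-1\<^esub>(\<cdot> | z)\<close>.\<close>
definition transition ::
    "('n::finite, 'm::finite) gm_model \<Rightarrow> nat \<Rightarrow> real^'n \<Rightarrow> (real^'n) measure" where
  "transition M t z = gaussian (trans_mat M t *v z + trans_shift M t) (trans_cov M t)"

text \<open>\<open>h\<^bsub>t|t\<^esub>(x)\<close> for the measurement sequence \<open>y\<close>.\<close>
definition meas_lik ::
    "('n::finite, 'm::finite) gm_model \<Rightarrow> (nat \<Rightarrow> real^'m) \<Rightarrow> nat \<Rightarrow> real^'n \<Rightarrow> real" where
  "meas_lik M y t x = gaussian_density (meas_mat M t *v x) (meas_cov M t) (y t)"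

text \<open>
  \<open>lik M y t s x\<close> is \<open>h\<^bsub>t:T|s\<^esub>(x)\<close> with \<open>T = horizon M\<close>, for \<open>t \<in> {1..T}\<close> and
  \<open>s \<in> {t - 1, t}\<close>, given by the backward recursion starting at \<open>t = s = T\<close>.
\<close>
function lik ::
    "('n::finite, 'm::finite) gm_model \<Rightarrow> (nat \<Rightarrow> real^'m) \<Rightarrow> nat \<Rightarrow> nat \<Rightarrow> real^'n \<Rightarrow> real" where
  "lik M y t s x =
     (if s = t then
        if t < horizon M then meas_lik M y t x * lik M y (Suc t) t x else meas_lik M y t x
      else if Suc s = t then \<integral>x'. lik M y t t x' \<partial>transition M t x
      else 0)"
  by pat_completeness auto
termination
  by (relation "Wellfounded.measure (\<lambda>(M, y, t, s, x). 2 * (horizon M - t) + (if s = t then 0 else 1))") auto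

declare lik.simps [simp del]

text \<open>The posterior transition \<open>\<pi>\<^bsup>t:T\<^esup>\<^bsub>t|t-1\<^esub>(\<cdot> | z)\<close>.\<close>
definition posterior_transition ::
    "('n::finite, 'm::finite) gm_model \<Rightarrow> (nat \<Rightarrow> real^'m) \<Rightarrow> nat \<Rightarrow> real^'n \<Rightarrow> (real^'n) measure" where
  "posterior_transition M y t z =
     density (transition M t z) (\<lambda>x. ennreal (lik M y t t x / lik M y t (t - 1) z))"

end

theory Submission
  imports Defs
begin

text \<open>
  By backward induction on \<open>t\<close>, every likelihood has the form \<open>c exp (-\<bar>y - C x\<bar>\<^sup>2 / 2)\<close> with a
  square \<open>C\<close>. Products keep this form: stacking the two least squares problems gives a linear map
  into a larger space, whose range has dimension at most \<open>n\<close> and so embeds isometrically into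
  \<open>real^'n\<close>; the part of the data orthogonal to the range only changes the constant.
  For the integration step, write the prior state as \<open>a + A w\<close> with \<open>w\<close> standard Gaussian and \<open>A A\<^sup>T = Q\<close>.
  The likelihood becomes \<open>exp (-\<bar>r - G w\<bar>\<^sup>2 / 2)\<close> with \<open>G = C A\<close> and \<open>r = y - C a\<close>; completing the square,
  the weighted law of \<open>w\<close> is that of \<open>K r + B v\<close> with \<open>v\<close> standard Gaussian, times the Gaussian-shaped factor
  \<open>k exp (-\<bar>L r\<bar>\<^sup>2 / 2)\<close>. Hence the posterior state is \<open>a + A K r + A B v\<close>, where \<open>a\<close> and \<open>r\<close> are affine
  in the previous state and neither \<open>Q\<close> nor the transition matrix has to be invertible.
\<close>

section \<open>Positive semidefinite matrices and their factorisations\<close>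

lemma inner_matrix_vector_transpose:
  fixes A :: "real^'n^'m"
  shows "x \<bullet> (A *v y) = (transpose A *v x) \<bullet> y"
  by (metis dot_lmul_matrix transpose_matrix_vector)

lemma psd_matrix_gram: "psd_matrix (A ** transpose A)"
  unfolding psd_matrix_def
proof (intro conjI allI)
  show "transpose (A ** transpose A) = A ** transpose A"
    by (simp add: matrix_transpose_mul)
  show "0 \<le> x \<bullet> (A ** transpose A *v x)" for x
    by (simp add: inner_matrix_vector_transpose flip: matrix_vector_mul_assoc)
qed

text \<open>If \<open>H $ i $ i = 0\<close> then \<open>v = 0\<close>, and division by zero returning zero makes the complement equal to \<open>H\<close>.\<close>

lemma psd_schur_complement:
  fixes H :: "real^'n^'n" and i :: 'n
  assumes H: "psd_matrix H"
  defines "v \<equiv> column i H"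
  shows "psd_matrix (\<chi> j k. H $ j $ k - v $ j * v $ k / H $ i $ i)" (is "psd_matrix ?H'")
    and "H $ i $ i = 0 \<Longrightarrow> v = 0" and "0 \<le> H $ i $ i"
proof -
  have sym: "transpose H = H" and nn: "0 \<le> x \<bullet> (H *v x)" for x
    using H by (auto simp: psd_matrix_def)
  have Hi: "H *v axis i 1 = v"
    by (simp add: v_def matrix_vector_mul_component vec_eq_iff inner_axis column_def matrix_vector_mult_basis)
  have vi: "v $ i = H $ i $ i" by (simp add: v_def column_def)
  have ei: "axis i 1 \<bullet> w = w $ i" for w :: "real^'n"
    by (simp add: inner_axis')
  \<comment> \<open>The quadratic form at \<open>x\<close> plus \<open>t\<close> times the unit
    vector \<open>axis i 1\<close> is a nonnegative polynomial in \<open>t\<close>. Both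
    \<open>v = 0\<close> and the semidefiniteness of \<open>?H'\<close> come from choosing
    \<open>t\<close>.\<close>
  have *: "0 \<le> x \<bullet> (H *v x) + 2 * t * (x \<bullet> v) + t\<^sup>2 * H $ i $ i" for x t
  proof -
    have "axis i 1 \<bullet> (H *v x) = x \<bullet> v"
      by (metis Hi inner_matrix_vector_transpose sym inner_commute)
    then have "(x + t *\<^sub>R axis i 1) \<bullet> (H *v (x + t *\<^sub>R axis i 1))
        = x \<bullet> (H *v x) + 2 * t * (x \<bullet> v) + t\<^sup>2 * H $ i $ i"
      by (simp add: matrix_vector_right_distrib matrix_vector_mult_scaleR Hi inner_add_left
          inner_add_right ei vi power2_eq_square algebra_simps)
    then show ?thesis by (metis nn)
  qed
  show d0: "0 \<le> H $ i $ i" using nn[of "axis i 1"] by (simp add: Hi ei vi)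
  show v0: "v = 0" if d: "H $ i $ i = 0"
  proof (rule ccontr)
    assume "v \<noteq> 0"
    then have "v \<bullet> v \<noteq> 0" by simp
    \<comment> \<open>With a zero diagonal entry the polynomial at \<open>v\<close> is affine in
      \<open>t\<close>; this \<open>t\<close> gives it the value \<open>-1\<close>.\<close>
    then have "2 * (- (v \<bullet> (H *v v) + 1) / (2 * (v \<bullet> v))) * (v \<bullet> v) = - (v \<bullet> (H *v v) + 1)"
      by (simp add: field_simps)
    with *[of v "- (v \<bullet> (H *v v) + 1) / (2 * (v \<bullet> v))"] show False
      by (simp add: d)
  qed
  have mul: "?H' *v x = H *v x - ((v \<bullet> x) / H $ i $ i) *\<^sub>R v" for x
    by (simp add: vec_eq_iff matrix_vector_mult_def algebra_simps sum_subtractf inner_vec_def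
        sum_distrib_left sum_divide_distrib)
  show "psd_matrix ?H'"
    unfolding psd_matrix_def
  proof (intro conjI allI)
    show "transpose ?H' = ?H'"
      using sym by (simp add: vec_eq_iff transpose_def mult.commute)
    show "0 \<le> x \<bullet> (?H' *v x)" for x
    proof (cases "H $ i $ i = 0")
      case True
      then show ?thesis using nn[of x] by (simp add: mul)
    next
      case False
      \<comment> \<open>This value of \<open>t\<close> minimises the polynomial, and the minimum is
        the quadratic form of \<open>?H'\<close>.\<close>
      then have "x \<bullet> (?H' *v x) =
          x \<bullet> (H *v x) + 2 * (- (x \<bullet> v) / H $ i $ i) * (x \<bullet> v) + (- (x \<bullet> v) / H $ i $ i)\<^sup>2 * H $ i $ i"
        unfolding mul by (simp add: inner_diff_right inner_commute field_simps power2_eq_square)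
      then show ?thesis using *[of x "- (x \<bullet> v) / H $ i $ i"] by simp
    qed
  qed
qed

text \<open>Symmetric Gaussian elimination: each pivot contributes one outer product and leaves a
  Schur complement that also vanishes in the pivot row. \<open>S\<close> contains the rows still to
  be eliminated.\<close>

lemma psd_matrix_sum_outer_products:
  fixes H :: "real^'n^'n"
  assumes "finite S" "psd_matrix H" "\<And>j k. j \<notin> S \<Longrightarrow> H $ j $ k = 0"
  shows "\<exists>a :: 'n \<Rightarrow> real^'n. \<forall>j k. H $ j $ k = (\<Sum>i\<in>S. a i $ j * a i $ k)"
  using assms
proof (induction S arbitrary: H)
  case empty
  then show ?case by simp
next
  case (insert i S)
  define v where "v = column i H"
  define H' where "H' = (\<chi> j k. H $ j $ k - v $ j * v $ k / H $ i $ i)"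
  note schur = psd_schur_complement[OF insert.prems(1), of i, folded v_def]
  have v: "v $ j = H $ j $ i" for j by (simp add: v_def column_def)
  have sym: "H $ j $ k = H $ k $ j" for j k
    using insert.prems(1) unfolding psd_matrix_def transpose_def vec_eq_iff by (metis vec_lambda_beta)
  \<comment> \<open>In row \<open>i\<close> the two terms cancel; for a zero pivot,
    \<open>v = 0\<close> and symmetry make that row of \<open>H\<close> zero. In the other rows
    outside \<open>S\<close>, both \<open>H $ j $ k\<close> and \<open>v $ j\<close> vanish.\<close>
  have "H' $ j $ k = 0" if "j \<notin> S" for j k
  proof (cases "j = i")
    case True
    then show ?thesis
      using arg_cong[OF schur(2), of "\<lambda>w. w $ k"] sym[of i k] v[of k] v[of i]
      by (cases "H $ i $ i = 0") (simp_all add: H'_def)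
  next
    case False
    then show ?thesis using insert.prems(2)[of j] that by (simp add: H'_def v)
  qed
  moreover have "psd_matrix H'" unfolding H'_def by (rule schur(1))
  ultimately obtain a where a: "\<And>j k. H' $ j $ k = (\<Sum>i\<in>S. a i $ j * a i $ k)"
    using insert.IH[of H'] by blast
  \<comment> \<open>For a zero pivot this column is zero, as is the eliminated term.\<close>
  let ?a = "a(i := (1 / sqrt (H $ i $ i)) *\<^sub>R v)"
  have "H $ j $ k = (\<Sum>l\<in>insert i S. ?a l $ j * ?a l $ k)" for j k
  proof -
    have "(\<Sum>l\<in>insert i S. ?a l $ j * ?a l $ k) = v $ j * v $ k / H $ i $ i + (\<Sum>l\<in>S. ?a l $ j * ?a l $ k)"
      using insert.hyps schur(3) by simp
    also have "(\<Sum>l\<in>S. ?a l $ j * ?a l $ k) = H' $ j $ k"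
      unfolding a using insert.hyps by (intro sum.cong) auto
    finally show ?thesis by (simp add: H'_def)
  qed
  then show ?case by blast
qed

lemma psd_matrix_factor:
  fixes H :: "real^'n^'n"
  assumes "psd_matrix H"
  obtains A :: "real^'n^'n" where "A ** transpose A = H"
proof -
  have "\<exists>a :: 'n \<Rightarrow> real^'n. \<forall>j k. H $ j $ k = (\<Sum>i\<in>UNIV. a i $ j * a i $ k)"
    by (rule psd_matrix_sum_outer_products) (use assms in auto)
  then obtain a :: "'n \<Rightarrow> real^'n" where "\<And>j k. H $ j $ k = (\<Sum>i\<in>UNIV. a i $ j * a i $ k)"
    by blast
  then have "(\<chi> j i. a i $ j) ** transpose (\<chi> j i. a i $ j) = H"
    by (simp add: vec_eq_iff matrix_matrix_mult_def transpose_def)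
  then show ?thesis by (rule that)
qed

lemma pd_imp_psd_matrix: "pd_matrix H \<Longrightarrow> psd_matrix H"
  unfolding pd_matrix_def psd_matrix_def
  by (metis inner_zero_left less_eq_real_def)

lemma pd_matrix_factor:
  fixes H :: "real^'n^'n"
  assumes "pd_matrix H"
  obtains A :: "real^'n^'n" where "A ** transpose A = H" "invertible A"
proof -
  obtain A :: "real^'n^'n" where A: "A ** transpose A = H"
    using psd_matrix_factor[OF pd_imp_psd_matrix[OF assms]] .
  have "inj ((*v) H)"
  proof (rule linear_injective_0[THEN iffD2, rule_format])
    show "x = 0" if "H *v x = 0" for x
      using assms that unfolding pd_matrix_def by (metis inner_zero_right less_irrefl)
  qed simp
  then have "invertible H"
    using matrix_left_invertible_injective invertible_left_inverse by blast
  then have "det A \<noteq> 0" using A by (auto simp: invertible_det_nz det_mul)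
  then show ?thesis using that A invertible_det_nz by blast
qed

text \<open>\<open>B\<close> is the inverse transpose of a square factor of \<open>H\<close>. It
  whitens measurement residuals, and it provides the substitution that completes the square in
  \<open>std_gaussian_tilt\<close>.\<close>

lemma pd_matrix_factor_inverse:
  fixes H :: "real^'n^'n"
  assumes "pd_matrix H"
  obtains B :: "real^'n^'n" where "B ** transpose B = matrix_inv H" "transpose B ** H ** B = mat 1"
    "invertible B" "0 < det H"
proof -
  obtain A :: "real^'n^'n" where A: "A ** transpose A = H" and inv: "invertible A"
    using pd_matrix_factor[OF assms] .
  obtain C where C: "A ** C = mat 1" "C ** A = mat 1" using inv by (auto simp: invertible_def)
  have tC: "transpose C ** transpose A = mat 1" "transpose A ** transpose C = mat 1"
    using C by (metis matrix_transpose_mul transpose_mat)+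
  have "transpose C ** C ** H = transpose C ** (C ** A) ** transpose A"
    by (simp add: A[symmetric] matrix_mul_assoc)
  then have left: "transpose C ** C ** H = mat 1" by (simp add: C tC)
  then have right: "H ** (transpose C ** C) = mat 1" by (rule matrix_left_right_inverse[THEN iffD1])
  \<comment> \<open>\<open>matrix_inv\<close> is defined by choice; once it is known to be an
    inverse, uniqueness identifies it with \<open>transpose C ** C\<close>.\<close>
  have "H ** matrix_inv H = mat 1 \<and> matrix_inv H ** H = mat 1"
    unfolding matrix_inv_def by (rule someI[where x = "transpose C ** C"]) (use left right in auto)
  then have "matrix_inv H = transpose C ** C"
    by (metis left matrix_mul_assoc matrix_mul_lid matrix_mul_rid)
  moreover have "C ** H ** transpose C = C ** A ** (transpose A ** transpose C)"
    by (simp add: A[symmetric] matrix_mul_assoc)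
  ultimately show ?thesis
  proof (intro that[of "transpose C"])
    show "0 < det H"
      using inv by (simp add: A[symmetric] det_mul invertible_det_nz) (metis not_real_square_gt_zero)
    show "invertible (transpose C)" using tC unfolding invertible_def by blast
  qed (use C tC in auto)
qed

section \<open>Isometric embeddings and orthogonal factors\<close>

text \<open>In the proof, \<open>d\<close> is the squared distance from \<open>p\<close> to the
  range of \<open>L\<close>. The codomain is an arbitrary Euclidean space, so that measurement
  residuals and stacked pairs are treated alike.\<close>

lemma least_squares_reduction:
  fixes L :: "real^'n \<Rightarrow> 'e::euclidean_space" and p :: 'e
  assumes "linear L"
  obtains d y and C :: "real^'n^'n" where
    "\<And>x. (norm (p - L x))\<^sup>2 = d + (norm (y - C *v x))\<^sup>2"
proof -
  have sub: "subspace (range L)" using assms by (simp add: linear_subspace_image)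
  obtain q z where q: "q \<in> span (range L)" and z: "\<And>w. w \<in> span (range L) \<Longrightarrow> orthogonal z w"
    and p: "p = q + z"
    using orthogonal_subspace_decomp_exists[of "range L" p] by blast
  have "dim (range L) \<le> dim (UNIV :: (real^'n) set)"
    using assms by (rule dim_image_le)
  then obtain f :: "'e \<Rightarrow> real^'n" where f: "linear f" "\<And>x. x \<in> range L \<Longrightarrow> norm (f x) = norm x"
    by (rule isometry_subset_subspace[OF sub subspace_UNIV]) (use that in blast)
  have lin: "linear (f \<circ> L)" using assms f(1) by (rule linear_compose)
  have "(norm (p - L x))\<^sup>2 = (norm z)\<^sup>2 + (norm (f q - matrix (f \<circ> L) *v x))\<^sup>2" for x
  proof -
    \<comment> \<open>\<open>f\<close> is known to preserve norms only on the range of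
      \<open>L\<close>, so the projected residual must lie there.\<close>
    have mem: "q - L x \<in> range L"
      using q sub by (simp add: span_eq_iff[THEN iffD2] subspace_diff)
    then have "orthogonal z (q - L x)" using z by (simp add: span_base)
    then have "(norm (z + (q - L x)))\<^sup>2 = (norm z)\<^sup>2 + (norm (q - L x))\<^sup>2"
      by (rule norm_add_Pythagorean)
    moreover have "p - L x = z + (q - L x)" by (simp add: p algebra_simps)
    moreover have "f q - matrix (f \<circ> L) *v x = f (q - L x)"
      using fun_cong[OF matrix_vector_mul(2)[OF lin], of x] f(1) by (simp add: linear_diff)
    ultimately show ?thesis using f(2)[OF mem] by presburger
  qed
  then show ?thesis by (rule that)
qed

text \<open>The map \<open>A\<^sup>T x \<mapsto> B\<^sup>T x\<close> is a well-defined isometry between the ranges; it is extended by an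
  isometry between their orthogonal complements.\<close>

lemma orthogonal_factor_of_equal_gram:
  fixes A B :: "real^'n^'n"
  assumes "A ** transpose A = B ** transpose B"
  obtains U :: "real^'n^'n" where "orthogonal_matrix U" "A = B ** U"
proof -
  let ?a = "(*v) (transpose A)" and ?b = "(*v) (transpose B)"
  have sq: "(norm (transpose A *v x))\<^sup>2 = x \<bullet> (A ** transpose A *v x)" for A :: "real^'n^'n" and x
    by (simp add: power2_norm_eq_inner inner_matrix_vector_transpose flip: matrix_vector_mul_assoc)
  have norm_eq: "norm (?a x) = norm (?b x)" for x
    by (metis sq assms norm_ge_zero power2_eq_imp_eq)
  define V where "V = range ?a"
  define W where "W = range ?b"
  have sub: "subspace V" "subspace W"
    unfolding V_def W_def by (intro linear_subspace_image; simp)+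
  obtain p where p: "linear p" "\<And>v. v \<in> V \<Longrightarrow> ?a (p v) = v"
    using linear_exists_right_inverse_on[of ?a UNIV] by (auto simp: V_def)
  define g where "g = ?b \<circ> p"
  have lg: "linear g" unfolding g_def using p(1) by (intro linear_compose) auto
  have g: "g (?a x) = ?b x" for x
  proof -
    \<comment> \<open>\<open>p (?a x) - x\<close> is in the kernel of \<open>?a\<close>, hence by
      \<open>norm_eq\<close> in that of \<open>?b\<close>; the choice of preimage made by
      \<open>p\<close> thus does not affect \<open>g\<close> on \<open>V\<close>.\<close>
    have "norm (?b (p (?a x) - x)) = norm (?a (p (?a x) - x))" by (simp only: norm_eq)
    also have "\<dots> = 0" using p(2)[of "?a x"] by (simp add: matrix_vector_mult_diff_distrib V_def)
    finally show ?thesis by (simp add: matrix_vector_mult_diff_distrib g_def)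
  qed
  have gV: "g v \<in> W" "norm (g v) = norm v" if "v \<in> V" for v
    using that g norm_eq by (auto simp: V_def W_def)
  have "W = g ` V" using g by (auto simp: V_def W_def image_image)
  then have dimWV: "dim W \<le> dim V" using lg by (simp add: dim_image_le)
  define V' where "V' = {y. \<forall>x\<in>V. orthogonal x y}"
  define W' where "W' = {y. \<forall>x\<in>W. orthogonal x y}"
  have sub': "subspace V'" "subspace W'"
    by (simp_all add: V'_def W'_def subspace_orthogonal_to_vectors)
  \<comment> \<open>Since \<open>g\<close> maps \<open>V\<close> onto \<open>W\<close>, the
    dimensions of the complements compare in the direction that embeds \<open>V'\<close> into
    \<open>W'\<close>.\<close>
  have "dim V' + dim V = dim W' + dim W"
    using dim_subspace_orthogonal_to_vectors[of V UNIV] dim_subspace_orthogonal_to_vectors[of W UNIV] sub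
    by (simp add: V'_def W'_def)
  then have "dim V' \<le> dim W'" using dimWV by simp
  then obtain h :: "real^'n \<Rightarrow> real^'n" where h: "linear h" "h \<in> V' \<rightarrow> W'" "\<And>x. x \<in> V' \<Longrightarrow> norm (h x) = norm x"
    using isometry_subset_subspace[OF sub'] by blast
  obtain E where E: "E \<subseteq> V" "pairwise orthogonal E" "span E = V"
    using orthonormal_basis_subspace[OF sub(1)] by metis
  \<comment> \<open>The orthogonal projection onto \<open>V\<close>, in Gram-Schmidt form.\<close>
  define P where "P x = (\<Sum>b\<in>E. (b \<bullet> x / (b \<bullet> b)) *\<^sub>R b)" for x :: "real^'n"
  have lP: "linear P"
    unfolding P_def by (intro linearI)
      (simp_all add: inner_add_right add_divide_distrib scaleR_add_left sum.distrib scaleR_sum_right)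
  have PV: "P x \<in> V" for x
    unfolding P_def by (metis (no_types, lifting) E(3) span_base span_scale span_sum)
  have PV': "x - P x \<in> V'" for x
    using Gram_Schmidt_step[OF E(2)] E(3) by (auto simp: V'_def P_def)
  have fixV: "P v = v" if "v \<in> V" for v
  proof -
    have "v - P v \<in> V" using that PV sub by (simp add: subspace_diff)
    then show ?thesis using PV'[of v] by (auto simp: V'_def orthogonal_self)
  qed
  define f where "f x = g (P x) + h (x - P x)" for x
  have lf: "linear f"
    unfolding f_def using linear_compose[OF lP lg] linear_compose[OF linear_compose_sub[OF linear_ident lP] h(1)]
    by (simp add: o_def linear_compose_add)
  have nf: "norm (f x) = norm x" for x
  proof -
    have "orthogonal (g (P x)) (h (x - P x))"
      using gV(1)[OF PV] h(2) PV'[of x] by (auto simp: W'_def)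
    then have "(norm (f x))\<^sup>2 = (norm (g (P x)))\<^sup>2 + (norm (h (x - P x)))\<^sup>2"
      unfolding f_def by (rule norm_add_Pythagorean)
    also have "\<dots> = (norm (P x))\<^sup>2 + (norm (x - P x))\<^sup>2"
      using gV(2)[OF PV] h(3)[OF PV'] by simp
    also have "\<dots> = (norm (P x + (x - P x)))\<^sup>2"
      using PV PV' by (intro norm_add_Pythagorean[symmetric]) (auto simp: V'_def)
    finally show ?thesis by simp
  qed
  have orth: "orthogonal_matrix (matrix f)"
    using lf nf orthogonal_transformation orthogonal_transformation_matrix by blast
  have "f (?a x) = ?b x" for x
    using fixV[of "?a x"] g[of x] h(1) by (simp add: f_def V_def linear_0)
  then have "matrix f ** transpose A = transpose B"
    using matrix_vector_mul(2)[OF lf] unfolding matrix_eq by (metis matrix_vector_mul_assoc)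
  then have "A ** transpose (matrix f) = B"
    by (metis matrix_transpose_mul transpose_transpose)
  then have "A = B ** matrix f"
    using orth by (metis matrix_mul_assoc matrix_mul_rid orthogonal_matrix_def)
  then show ?thesis using orth that by blast
qed

section \<open>Lebesgue measure under translations and linear maps\<close>

lemma nn_integral_lborel_shift:
  fixes f :: "'a::euclidean_space \<Rightarrow> ennreal"
  assumes [measurable]: "f \<in> borel_measurable borel"
  shows "(\<integral>\<^sup>+x. f (a + x) \<partial>lborel) = (\<integral>\<^sup>+x. f x \<partial>lborel)"
proof -
  have "(\<integral>\<^sup>+x. f (a + x) \<partial>lborel) = (\<integral>\<^sup>+x. f x \<partial>distr lborel borel ((+) a))"
    by (simp add: nn_integral_distr)
  then show ?thesis by (simp add: lborel_distr_plus)
qed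

text \<open>This is the Fubini proof of the uniqueness of translation-invariant measures, applied to the image of
  \<open>lborel\<close> under \<open>B\<close>. The determinant version of the library needs a well-ordered index type.\<close>

lemma nn_integral_lborel_linear_scaling:
  fixes B :: "'a::euclidean_space \<Rightarrow> 'a" and f g :: "'a \<Rightarrow> ennreal"
  assumes "linear B" "surj B" and [measurable]: "f \<in> borel_measurable borel" "g \<in> borel_measurable borel"
    and g: "(\<integral>\<^sup>+x. g x \<partial>lborel) = 1"
  shows "(\<integral>\<^sup>+x. f (B x) \<partial>lborel) = (\<integral>\<^sup>+x. g (- B x) \<partial>lborel) * (\<integral>\<^sup>+x. f x \<partial>lborel)"
proof -
  have [measurable]: "B \<in> borel_measurable borel"
    using assms(1) by (intro borel_measurable_continuous_onI linear_continuous_on) (simp add: linear_conv_bounded_linear)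
  \<comment> \<open>Surjectivity turns a translation of the value \<open>B x\<close> into a
    translation of \<open>x\<close>.\<close>
  have shift: "(\<integral>\<^sup>+x. h (B x + y) \<partial>lborel) = (\<integral>\<^sup>+x. h (B x) \<partial>lborel)"
    if [measurable]: "h \<in> borel_measurable borel" for h :: "'a \<Rightarrow> ennreal" and y
  proof -
    obtain z where "B z = y" using assms(2) by (metis surj_def)
    then have "h (B x + y) = h (B (z + x))" for x using assms(1) by (simp add: linear_add add.commute)
    then show ?thesis using nn_integral_lborel_shift[of "\<lambda>x. h (B x)" z] by simp
  qed
  have "(\<integral>\<^sup>+x. f (B x) \<partial>lborel) = (\<integral>\<^sup>+y. g y * (\<integral>\<^sup>+x. f (B x) \<partial>lborel) \<partial>lborel)"
    by (simp add: nn_integral_multc g)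
  also have "\<dots> = (\<integral>\<^sup>+y. \<integral>\<^sup>+x. g y * f (B x + y) \<partial>lborel \<partial>lborel)"
    by (simp add: nn_integral_cmult shift)
  also have "\<dots> = (\<integral>\<^sup>+x. \<integral>\<^sup>+y. g y * f (B x + y) \<partial>lborel \<partial>lborel)"
    by (rule lborel_pair.Fubini') measurable
  also have "\<dots> = (\<integral>\<^sup>+x. \<integral>\<^sup>+y. g (- B x + y) * f y \<partial>lborel \<partial>lborel)"
  proof (rule nn_integral_cong)
    show "(\<integral>\<^sup>+y. g y * f (B x + y) \<partial>lborel) = (\<integral>\<^sup>+y. g (- B x + y) * f y \<partial>lborel)" for x
      using nn_integral_lborel_shift[of "\<lambda>y. g (- B x + y) * f y" "B x"] by simp
  qed
  also have "\<dots> = (\<integral>\<^sup>+y. \<integral>\<^sup>+x. g (- B x + y) * f y \<partial>lborel \<partial>lborel)"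
    by (rule lborel_pair.Fubini'[symmetric]) measurable
  also have "\<dots> = (\<integral>\<^sup>+y. (\<integral>\<^sup>+x. g (- B x) \<partial>lborel) * f y \<partial>lborel)"
  proof (rule nn_integral_cong)
    fix y
    have "(\<integral>\<^sup>+x. g (- B x + y) \<partial>lborel) = (\<integral>\<^sup>+x. g (- B x) \<partial>lborel)"
      using shift[of "\<lambda>w. g (- w)" "- y"] by simp
    then show "(\<integral>\<^sup>+x. g (- B x + y) * f y \<partial>lborel) = (\<integral>\<^sup>+x. g (- B x) \<partial>lborel) * f y"
      by (simp add: nn_integral_multc)
  qed
  also have "\<dots> = (\<integral>\<^sup>+x. g (- B x) \<partial>lborel) * (\<integral>\<^sup>+x. f x \<partial>lborel)"
    by (simp add: nn_integral_cmult)
  finally show ?thesis .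
qed

text \<open>\<open>k\<close> is the reciprocal of the factor from the scaling lemma. The isometry
  clause speaks of the same \<open>k\<close>; it holds because the preimage of the unit ball under
  an isometry is the unit ball.\<close>

lemma nn_integral_lborel_linear:
  fixes B :: "'a::euclidean_space \<Rightarrow> 'a"
  assumes "linear B" "inj B"
  shows "\<exists>k>0. (\<forall>f. f \<in> borel_measurable borel \<longrightarrow>
      (\<integral>\<^sup>+x. f x \<partial>lborel) = ennreal k * (\<integral>\<^sup>+x. f (B x) \<partial>lborel)) \<and>
    ((\<forall>x. norm (B x) = norm x) \<longrightarrow> k = 1)"
proof -
  have surj: "surj B" using assms by (simp add: linear_injective_imp_surjective)
  have meas: "B' \<in> borel_measurable borel" if "linear B'" for B' :: "'a \<Rightarrow> 'a"
    using that by (intro borel_measurable_continuous_onI linear_continuous_on) (simp add: linear_conv_bounded_linear)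
  note [measurable] = meas[OF assms(1)]
  \<comment> \<open>The indicator of the unit cube serves as the weight \<open>g\<close> of integral
    \<open>1\<close>.\<close>
  define c where "c = (\<integral>\<^sup>+x. indicator (cbox 0 One) (- B x) \<partial>(lborel :: 'a measure))"
  have unit: "(\<integral>\<^sup>+x. indicator (cbox 0 One) x \<partial>(lborel :: 'a measure)) = 1"
    by (simp add: inner_diff_left)
  have c: "(\<integral>\<^sup>+x. f (B x) \<partial>lborel) = c * (\<integral>\<^sup>+x. f x \<partial>lborel)"
    if "f \<in> borel_measurable borel" for f
    unfolding c_def using assms(1) surj that unit by (intro nn_integral_lborel_linear_scaling) auto
  let ?v = "emeasure lborel (cball 0 1 :: 'a set)"
  have v: "0 < ?v" "?v < \<infinity>"
    using emeasure_lborel_cball_finite emeasure_cball[of 1 "0::'a"]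
    by (auto simp: unit_ball_vol_pos less_top)
  obtain B' where B': "linear B'" "B' \<circ> B = id"
    using linear_injective_left_inverse[OF assms] by blast
  \<comment> \<open>The volume of the ball, positive and finite, becomes \<open>c\<close> times
    another measure; this excludes \<open>c = 0\<close> and \<open>c = \<infinity>\<close>.\<close>
  have "?v = (\<integral>\<^sup>+x. indicator (cball 0 1) (B' (B x)) \<partial>lborel)"
    using B'(2) by (simp add: fun_eq_iff)
  also have "\<dots> = c * (\<integral>\<^sup>+x. indicator (cball 0 1) (B' x) \<partial>lborel)"
    by (intro c measurable_compose[OF meas[OF B'(1)]] borel_measurable_indicator borel_closed) auto
  finally have *: "?v = c * (\<integral>\<^sup>+x. indicator (cball 0 1) (B' x) \<partial>lborel)" .
  with v have "c \<noteq> 0" by auto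
  moreover have "c \<noteq> \<infinity>"
  proof
    assume "c = \<infinity>"
    with * v show False by (simp add: ennreal_top_mult split: if_splits)
  qed
  ultimately obtain r where r: "c = ennreal r" "0 < r"
    by (cases c) (auto simp: less_le)
  show ?thesis
  proof (intro exI[of _ "1 / r"] conjI allI impI)
    show "0 < 1 / r" using r by simp
    show "(\<integral>\<^sup>+x. f x \<partial>lborel) = ennreal (1 / r) * (\<integral>\<^sup>+x. f (B x) \<partial>lborel)"
      if "f \<in> borel_measurable borel" for f
      using r by (simp add: c[OF that] r(1) mult.assoc[symmetric] ennreal_mult[symmetric])
    show "1 / r = 1" if n: "\<forall>x. norm (B x) = norm x"
    proof -
      have "(\<integral>\<^sup>+x. indicator (cball 0 1) (B x) \<partial>lborel) = ?v"
      proof -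
        have "indicator (cball 0 1) (B x) = (indicator (cball 0 1) x :: ennreal)" for x
          by (simp add: indicator_def n)
        then show ?thesis by simp
      qed
      moreover have "(\<integral>\<^sup>+x. indicator (cball 0 1) (B x) \<partial>lborel) = c * ?v"
        by (subst c) (auto intro!: borel_measurable_indicator)
      ultimately have "ennreal r * ?v = 1 * ?v" using r by simp
      then show ?thesis
        using v r by (cases ?v) (auto simp: ennreal_mult[symmetric])
    qed
  qed
qed

section \<open>Standard and degenerate Gaussians, and completing the square\<close>

lemma std_gaussian_eq:
  "(std_gaussian :: (real^'n) measure) =
     density lborel (\<lambda>x. ennreal ((1 / sqrt (2 * pi)) ^ CARD('n) * exp (- (1/2) * (norm x)\<^sup>2)))"
proof -
  have "(\<Prod>i\<in>UNIV. std_normal_density (x $ i)) =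
      (1 / sqrt (2 * pi)) ^ CARD('n) * exp (- (1/2) * (norm x)\<^sup>2)" for x :: "real^'n"
    by (simp add: std_normal_density_def prod.distrib exp_sum[symmetric] norm_vec_def L2_set_def
        real_sqrt_pow2 sum_nonneg sum_negf sum_divide_distrib prod_dividef power_divide)
  then show ?thesis by (simp add: std_gaussian_def)
qed

lemma space_std_gaussian [simp]: "space std_gaussian = UNIV"
  by (simp add: std_gaussian_def)

lemma sets_std_gaussian [simp, measurable_cong]: "sets std_gaussian = sets borel"
  by (simp add: std_gaussian_def)

lemma prob_space_std_gaussian: "prob_space (std_gaussian :: (real^'n) measure)"
proof
  have Basis: "(Basis :: (real^'n) set) = (\<lambda>i. axis i 1) ` UNIV"
    by (auto simp: Basis_vec_def)
  have inj: "inj (\<lambda>i::'n. axis i (1::real))" by (auto simp: inj_on_def axis_eq_axis)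
  have "emeasure (std_gaussian :: (real^'n) measure) UNIV =
      (\<integral>\<^sup>+x. (\<Prod>b\<in>Basis. ennreal (std_normal_density (x \<bullet> b))) \<partial>(lborel :: (real^'n) measure))"
    unfolding std_gaussian_def
    by (simp add: emeasure_density Basis prod.reindex[OF inj] inner_axis prod_ennreal)
  also have "\<dots> = (\<Prod>b\<in>(Basis :: (real^'n) set). \<integral>\<^sup>+x. ennreal (std_normal_density x) \<partial>lborel)"
    by (rule nn_integral_lborel_prod) auto
  also have "(\<integral>\<^sup>+x. ennreal (std_normal_density x) \<partial>lborel) = 1"
    using prob_space.emeasure_space_1[OF prob_space_normal_density[of 1 0]]
    by (simp add: emeasure_density)
  finally show "emeasure (std_gaussian :: (real^'n) measure) (space std_gaussian) = 1" by simp
qed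

lemma borel_measurable_matrix_vector_mult [measurable (raw)]:
  fixes A :: "real^'n^'m"
  assumes "f \<in> borel_measurable M"
  shows "(\<lambda>x. A *v f x) \<in> borel_measurable M"
  using assms by (rule borel_measurable_continuous_on[rotated])
    (intro linear_continuous_on, simp add: linear_conv_bounded_linear[symmetric])

lemma nn_integral_std_gaussian:
  fixes f :: "real^'n \<Rightarrow> ennreal"
  assumes "f \<in> borel_measurable borel"
  shows "(\<integral>\<^sup>+x. f x \<partial>std_gaussian) =
    (\<integral>\<^sup>+x. ennreal ((1 / sqrt (2 * pi)) ^ CARD('n) * exp (- (1/2) * (norm x)\<^sup>2)) * f x \<partial>lborel)"
  unfolding std_gaussian_eq using assms by (intro nn_integral_density) auto

text \<open>The density depends on the norm only, and an isometry scales Lebesgue measure by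
  \<open>1\<close>.\<close>

lemma distr_std_gaussian_orthogonal:
  fixes U :: "real^'n^'n"
  assumes "orthogonal_matrix U"
  shows "distr std_gaussian borel ((*v) U) = std_gaussian"
proof (rule measure_eqI)
  fix X :: "(real^'n) set"
  assume "X \<in> sets (distr std_gaussian borel ((*v) U))"
  then have [measurable]: "X \<in> sets borel" by simp
  have orth: "orthogonal_transformation ((*v) U)"
    using assms by (simp add: orthogonal_transformation_matrix)
  then have norm: "norm (U *v x) = norm x" for x
    by (simp add: orthogonal_transformation)
  let ?d = "\<lambda>x::real^'n. ennreal ((1 / sqrt (2 * pi)) ^ CARD('n) * exp (- (1/2) * (norm x)\<^sup>2))"
  obtain k :: real where "0 < k" and k: "\<And>f. f \<in> borel_measurable borel \<Longrightarrow>
      (\<integral>\<^sup>+x. f x \<partial>lborel) = ennreal k * (\<integral>\<^sup>+x. f (U *v x) \<partial>lborel)"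
      "k = 1"
    using nn_integral_lborel_linear[OF matrix_vector_mul_linear orthogonal_transformation_inj[OF orth]] norm by blast
  have "emeasure (distr std_gaussian borel ((*v) U)) X = (\<integral>\<^sup>+x. indicator X x \<partial>distr std_gaussian borel ((*v) U))"
    by simp
  also have "\<dots> = (\<integral>\<^sup>+x. indicator X (U *v x) \<partial>std_gaussian)"
    by (rule nn_integral_distr) measurable
  also have "\<dots> = (\<integral>\<^sup>+x. ?d (U *v x) * indicator X (U *v x) \<partial>lborel)"
    unfolding norm by (rule nn_integral_std_gaussian) measurable
  also have "\<dots> = (\<integral>\<^sup>+x. ?d x * indicator X x \<partial>lborel)"
    using k(1)[of "\<lambda>x. ?d x * indicator X x"] k(2) by simp
  also have "\<dots> = emeasure std_gaussian X"
    by (subst nn_integral_std_gaussian[symmetric]) simp_all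
  finally show "emeasure (distr std_gaussian borel ((*v) U)) X = emeasure std_gaussian X" .
qed simp

text \<open>Frees \<open>gaussian\<close> from its choice of factor: the chosen one is
  \<open>A\<close> times an orthogonal matrix on the right, which the standard Gaussian
  absorbs.\<close>

lemma gaussian_gram:
  fixes A :: "real^'n^'n"
  shows "gaussian \<mu> (A ** transpose A) = distr std_gaussian borel (\<lambda>z. \<mu> + A *v z)"
proof -
  define B :: "real^'n^'n" where "B = (SOME B. B ** transpose B = A ** transpose A)"
  have "B ** transpose B = A ** transpose A"
    unfolding B_def by (rule someI) (rule refl)
  then obtain U :: "real^'n^'n" where U: "orthogonal_matrix U" "B = A ** U"
    by (rule orthogonal_factor_of_equal_gram)
  have "gaussian \<mu> (A ** transpose A) = distr std_gaussian borel ((\<lambda>z. \<mu> + A *v z) \<circ> (*v) U)"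
    by (simp add: gaussian_def B_def[symmetric] U(2) matrix_vector_mul_assoc o_def)
  also have "\<dots> = distr (distr std_gaussian borel ((*v) U)) borel (\<lambda>z. \<mu> + A *v z)"
    by (rule distr_distr[symmetric]) measurable
  finally show ?thesis by (simp add: distr_std_gaussian_orthogonal[OF U(1)])
qed

text \<open>With \<open>S = I + G\<^sup>T G\<close>, take \<open>B\<close> with \<open>B\<^sup>T S B = I\<close> and \<open>K r = S\<^sup>-\<^sup>1 G\<^sup>T r\<close>, the minimiser of
  \<open>\<bar>w\<bar>\<^sup>2 + \<bar>r - G w\<bar>\<^sup>2\<close>; then \<open>\<bar>L r\<bar>\<^sup>2\<close> is the minimum.\<close>

lemma std_gaussian_tilt:
  fixes G :: "real^'n^'n"
  shows "\<exists>k>0. \<exists>(K :: real^'n^'n) (B :: real^'n^'n) (L :: real^'n \<Rightarrow> (real^'n) \<times> (real^'n)). linear L \<and>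
    (\<forall>f r. f \<in> borel_measurable borel \<longrightarrow>
      (\<integral>\<^sup>+w. f w * ennreal (exp (- (1/2) * (norm (r - G *v w))\<^sup>2)) \<partial>std_gaussian) =
      ennreal (k * exp (- (1/2) * (norm (L r))\<^sup>2)) * (\<integral>\<^sup>+v. f (K *v r + B *v v) \<partial>std_gaussian))"
proof -
  define S where "S = mat 1 + transpose G ** G"
  have Sv: "S *v x = x + transpose G *v (G *v x)" for x
    by (simp add: S_def matrix_vector_mult_add_rdistrib matrix_vector_mul_assoc)
  have S: "x \<bullet> (S *v y) = x \<bullet> y + (G *v x) \<bullet> (G *v y)" for x y
  proof -
    have "x \<bullet> (transpose G *v (G *v y)) = (G *v x) \<bullet> (G *v y)"
      by (metis inner_matrix_vector_transpose transpose_transpose)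
    then show ?thesis by (simp only: Sv inner_add_right)
  qed
  have "pd_matrix S"
    unfolding pd_matrix_def
  proof (intro conjI allI impI)
    have "transpose (transpose G ** G) = transpose G ** G" by (simp add: matrix_transpose_mul)
    then show "transpose S = S"
      by (simp add: S_def transpose_def vec_eq_iff mat_def)
    show "0 < x \<bullet> (S *v x)" if "x \<noteq> 0" for x
      using that by (simp add: S add_pos_nonneg)
  qed
  then obtain B :: "real^'n^'n" where B: "transpose B ** S ** B = mat 1" "invertible B"
    using pd_matrix_factor_inverse by blast
  \<comment> \<open>Regrouping turns a left inverse into a right inverse:
    \<open>B ** transpose B\<close> is the inverse of \<open>S\<close>.\<close>
  have "transpose B ** (S ** B) = mat 1" using B(1) by (simp add: matrix_mul_assoc)
  then have "S ** B ** transpose B = mat 1"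
    by (rule matrix_left_right_inverse[THEN iffD1])
  then have SB: "S ** (B ** transpose B) = mat 1" by (simp add: matrix_mul_assoc)
  define K where "K = B ** transpose B ** transpose G"
  have SK: "S *v (K *v r) = transpose G *v r" for r
    using SB by (simp add: K_def matrix_vector_mul_assoc matrix_mul_assoc del: transpose_matrix_vector)
  define L where "L r = (K *v r, r - G *v (K *v r))" for r
  have "linear L"
    by (rule linearI) (simp_all add: L_def matrix_vector_right_distrib matrix_vector_mult_scaleR algebra_simps)
  \<comment> \<open>\<open>SK\<close> is the normal equation and cancels the terms linear in
    \<open>v\<close>; \<open>transpose B ** S ** B = mat 1\<close> reduces the quadratic terms to
    \<open>v \<bullet> v\<close>.\<close>
  have square: "(norm (K *v r + B *v v))\<^sup>2 + (norm (r - G *v (K *v r + B *v v)))\<^sup>2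
      = (norm (L r))\<^sup>2 + (norm v)\<^sup>2" for r v
  proof -
    have "(B *v v) \<bullet> (S *v (B *v v)) = v \<bullet> (transpose B ** S ** B *v v)"
      by (simp only: inner_matrix_vector_transpose[of v] matrix_vector_mul_assoc[symmetric] transpose_transpose)
    then have Bv: "(B *v v) \<bullet> (B *v v) + (G *v (B *v v)) \<bullet> (G *v (B *v v)) = v \<bullet> v"
      using B(1) by (simp add: S)
    have cross: "(B *v v) \<bullet> (K *v r) + (G *v (B *v v)) \<bullet> (G *v (K *v r)) = (G *v (B *v v)) \<bullet> r"
      using SK[of r] S[of "B *v v" "K *v r"] by (metis inner_matrix_vector_transpose transpose_transpose)
    have "(norm (L r))\<^sup>2 = (norm (K *v r))\<^sup>2 + (norm (r - G *v (K *v r)))\<^sup>2"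
      by (simp add: L_def norm_Pair)
    then show ?thesis
      using Bv cross
      by (simp add: power2_norm_eq_inner matrix_vector_right_distrib inner_add_left
          inner_add_right inner_diff_left inner_diff_right inner_commute algebra_simps)
  qed
  have "inj ((*v) B)" using B(2) by (rule inj_matrix_vector_mult)
  then obtain k :: real where k: "0 < k" "\<And>f. f \<in> borel_measurable borel \<Longrightarrow>
      (\<integral>\<^sup>+x. f x \<partial>lborel) = ennreal k * (\<integral>\<^sup>+x. f (B *v x) \<partial>lborel)"
    using nn_integral_lborel_linear[OF matrix_vector_mul_linear] by blast
  let ?a = "(1 / sqrt (2 * pi)) ^ CARD('n)"
  let ?e = "\<lambda>x. exp (- (1/2) * (norm x)\<^sup>2)"
  have "(\<integral>\<^sup>+w. f w * ennreal (?e (r - G *v w)) \<partial>std_gaussian) =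
      ennreal (k * ?e (L r)) * (\<integral>\<^sup>+v. f (K *v r + B *v v) \<partial>std_gaussian)"
    if [measurable]: "f \<in> borel_measurable borel" for f r
  proof -
    \<comment> \<open>\<open>F\<close> is the full integrand against Lebesgue measure. The
      substitution \<open>w = K *v r + B *v v\<close> is then a translation followed by a linear map
      with Jacobian factor \<open>k\<close>.\<close>
    define F where "F w = ennreal (?a * ?e w) * (f w * ennreal (?e (r - G *v w)))" for w
    have [measurable]: "F \<in> borel_measurable borel" unfolding F_def by measurable
    have F: "F (K *v r + B *v v) = ennreal (?e (L r)) * (ennreal (?a * ?e v) * f (K *v r + B *v v))" for v
    proof -
      let ?w = "K *v r + B *v v"
      have e: "?e ?w * ?e (r - G *v ?w) = ?e (L r) * ?e v"
        using square[of r v] by (simp add: exp_add[symmetric] field_simps)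
      have "?a * ?e ?w * ?e (r - G *v ?w) = ?e (L r) * (?a * ?e v)"
        using arg_cong[OF e, of "(*) ?a"] by (simp only: mult_ac)
      then have "ennreal (?a * ?e ?w) * ennreal (?e (r - G *v ?w)) = ennreal (?e (L r)) * ennreal (?a * ?e v)"
        by (simp add: ennreal_mult'[symmetric] del: ennreal_mult_eq_top_iff)
      then show ?thesis by (simp add: F_def mult_ac)
    qed
    have "(\<integral>\<^sup>+w. f w * ennreal (?e (r - G *v w)) \<partial>std_gaussian) = (\<integral>\<^sup>+w. F w \<partial>lborel)"
      unfolding F_def by (rule nn_integral_std_gaussian) measurable
    also have "\<dots> = (\<integral>\<^sup>+w. F (K *v r + w) \<partial>lborel)"
      by (simp add: nn_integral_lborel_shift)
    also have "\<dots> = ennreal k * (\<integral>\<^sup>+v. F (K *v r + B *v v) \<partial>lborel)"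
      by (rule k(2)) measurable
    also have "\<dots> = ennreal k * (ennreal (?e (L r)) * (\<integral>\<^sup>+v. ennreal (?a * ?e v) * f (K *v r + B *v v) \<partial>lborel))"
      unfolding F by (subst nn_integral_cmult) simp_all
    also have "(\<integral>\<^sup>+v. ennreal (?a * ?e v) * f (K *v r + B *v v) \<partial>lborel) =
        (\<integral>\<^sup>+v. f (K *v r + B *v v) \<partial>std_gaussian)"
      by (rule nn_integral_std_gaussian[symmetric]) measurable
    finally show ?thesis using k(1) by (simp add: ennreal_mult mult.assoc)
  qed
  then show ?thesis using k(1) \<open>linear L\<close> by blast
qed

section \<open>Functions of Gaussian shape\<close>

text \<open>The square, possibly singular \<open>C\<close> fixes the dimension, so that products and
  transition integrals stay inside one class.\<close>

definition gaussian_shaped :: "(real^'n \<Rightarrow> real) \<Rightarrow> bool" where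
  "gaussian_shaped h \<longleftrightarrow> (\<exists>c y. \<exists>C :: real^'n^'n.
     0 < c \<and> h = (\<lambda>x. c * exp (- (1/2) * (norm (y - C *v x))\<^sup>2)))"

lemma gaussian_shaped_least_squares:
  fixes L :: "real^'n \<Rightarrow> 'e::euclidean_space"
  assumes "0 < c" "linear L"
  shows "gaussian_shaped (\<lambda>x. c * exp (- (1/2) * (norm (p - L x))\<^sup>2))"
proof -
  obtain d y and C :: "real^'n^'n" where eq: "\<And>x. (norm (p - L x))\<^sup>2 = d + (norm (y - C *v x))\<^sup>2"
    using least_squares_reduction[OF assms(2)] by metis
  have "c * exp (- (1/2) * (norm (p - L x))\<^sup>2) =
      (c * exp (- (1/2) * d)) * exp (- (1/2) * (norm (y - C *v x))\<^sup>2)" for x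
    unfolding eq by (simp only: distrib_left exp_add mult.assoc)
  then show ?thesis
    unfolding gaussian_shaped_def using assms(1) by (metis exp_gt_zero mult_pos_pos)
qed

lemma gaussian_shaped_mult:
  fixes f g :: "real^'n \<Rightarrow> real"
  assumes "gaussian_shaped f" "gaussian_shaped g"
  shows "gaussian_shaped (\<lambda>x. f x * g x)"
proof -
  obtain c y and C :: "real^'n^'n" where f: "0 < c" "f = (\<lambda>x. c * exp (- (1/2) * (norm (y - C *v x))\<^sup>2))"
    using assms(1) by (auto simp: gaussian_shaped_def)
  obtain d z and D :: "real^'n^'n" where g: "0 < d" "g = (\<lambda>x. d * exp (- (1/2) * (norm (z - D *v x))\<^sup>2))"
    using assms(2) by (auto simp: gaussian_shaped_def)
  have "f x * g x = (c * d) * exp (- (1/2) * (norm ((y, z) - (C *v x, D *v x)))\<^sup>2)" for x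
  proof -
    have "(norm ((y, z) - (C *v x, D *v x)))\<^sup>2 = (norm (y - C *v x))\<^sup>2 + (norm (z - D *v x))\<^sup>2"
      by (simp add: norm_Pair)
    then show ?thesis by (simp only: f g distrib_left exp_add mult_ac)
  qed
  moreover have "linear (\<lambda>x. (C *v x, D *v x))"
    by (rule linearI) (simp_all add: matrix_vector_right_distrib matrix_vector_mult_scaleR)
  ultimately show ?thesis
    using gaussian_shaped_least_squares[of "c * d" "\<lambda>x. (C *v x, D *v x)" "(y, z)"] f(1) g(1) by simp
qed

text \<open>Passes to the encoding of the final claim, where the row dimension is a number:
  enumerating the index type numbers the rows of \<open>C\<close>.\<close>

lemma gaussian_shaped_coordinates:
  fixes h :: "real^'n \<Rightarrow> real"
  assumes "gaussian_shaped h"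
  shows "\<exists>c (y'::nat \<Rightarrow> real) (C'::nat \<Rightarrow> real^'n).
    0 < c \<and> (\<forall>x. h x = c * exp (- (1/2) * (\<Sum>i<CARD('n). (y' i - C' i \<bullet> x)\<^sup>2)))"
proof -
  obtain c y and C :: "real^'n^'n" where h: "0 < c" "h = (\<lambda>x. c * exp (- (1/2) * (norm (y - C *v x))\<^sup>2))"
    using assms by (auto simp: gaussian_shaped_def)
  obtain e :: "nat \<Rightarrow> 'n" where e: "bij_betw e {..<CARD('n)} UNIV"
    using ex_bij_betw_nat_finite[of "UNIV :: 'n set"] by (auto simp: atLeast0LessThan)
  have "(norm (y - C *v x))\<^sup>2 = (\<Sum>i<CARD('n). (y $ e i - (C $ e i) \<bullet> x)\<^sup>2)" for x
  proof -
    have "(norm (y - C *v x))\<^sup>2 = (\<Sum>j\<in>UNIV. (y $ j - (C $ j) \<bullet> x)\<^sup>2)"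
      unfolding power2_norm_eq_inner
      by (simp add: inner_vec_def power2_eq_square matrix_vector_mult_def)
    also have "\<dots> = (\<Sum>i<CARD('n). (y $ e i - (C $ e i) \<bullet> x)\<^sup>2)"
      by (rule sum.reindex_bij_betw[OF e, symmetric])
    finally show ?thesis .
  qed
  then show ?thesis
    using h by (intro exI[of _ c] exI[of _ "\<lambda>i. y $ e i"] exI[of _ "\<lambda>i. C $ e i"]) simp
qed

text \<open>A factor \<open>B\<close> of the inverse covariance turns the Mahalanobis norm of the
  residual into a Euclidean norm.\<close>

lemma meas_lik_gaussian_shaped:
  fixes M :: "('n::finite, 'm::finite) gm_model"
  assumes "pd_matrix (meas_cov M t)"
  shows "gaussian_shaped (meas_lik M y t)"
proof -
  let ?R = "meas_cov M t"
  obtain B :: "real^'m^'m" where B: "B ** transpose B = matrix_inv ?R" "0 < det ?R"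
    using pd_matrix_factor_inverse[OF assms] by metis
  let ?c = "1 / sqrt ((2 * pi) ^ CARD('m) * det ?R)"
  define L where "L x = transpose B *v (meas_mat M t *v x)" for x
  have "meas_lik M y t x = ?c * exp (- (1/2) * (norm (transpose B *v y t - L x))\<^sup>2)" for x
  proof -
    define w where "w = y t - meas_mat M t *v x"
    have "w \<bullet> (matrix_inv ?R *v w) = (norm (transpose B *v w))\<^sup>2"
      unfolding power2_norm_eq_inner B(1)[symmetric] matrix_vector_mul_assoc[symmetric]
      by (rule inner_matrix_vector_transpose)
    moreover have "transpose B *v y t - L x = transpose B *v w"
      by (simp only: L_def w_def matrix_vector_mult_diff_distrib)
    ultimately show ?thesis
      by (simp add: meas_lik_def gaussian_density_def w_def[symmetric] del: transpose_matrix_vector)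
  qed
  then have "meas_lik M y t = (\<lambda>x. ?c * exp (- (1/2) * (norm (transpose B *v y t - L x))\<^sup>2))"
    by (rule ext)
  moreover have "linear L"
    unfolding L_def by (rule linearI) (simp_all only: matrix_vector_right_distrib matrix_vector_mult_scaleR)
  moreover have "0 < ?c" using B(2) by simp
  ultimately show ?thesis
    using gaussian_shaped_least_squares[of ?c L "transpose B *v y t"] by simp
qed

section \<open>Integration against a transition and conditioning\<close>

text \<open>One tilt identity yields both claims: the mass of the weighted prior is the new
  likelihood, and its normalisation is the posterior.\<close>

lemma gaussian_conditioning:
  fixes h :: "real^'n \<Rightarrow> real" and \<Phi> Q :: "real^'n^'n" and u :: "real^'n"
  assumes "psd_matrix Q" "gaussian_shaped h"
  defines "H \<equiv> (\<lambda>z. \<integral>x. h x \<partial>gaussian (\<Phi> *v z + u) Q)"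
  shows "gaussian_shaped H"
    and "\<exists>(\<Phi>'::real^'n^'n) u' (Q'::real^'n^'n). psd_matrix Q' \<and>
      (\<forall>z. density (gaussian (\<Phi> *v z + u) Q) (\<lambda>x. ennreal (h x / H z)) = gaussian (\<Phi>' *v z + u') Q')"
proof -
  obtain A :: "real^'n^'n" where A: "A ** transpose A = Q" using psd_matrix_factor[OF assms(1)] .
  obtain c y and C :: "real^'n^'n" where h: "0 < c" "h = (\<lambda>x. c * exp (- (1/2) * (norm (y - C *v x))\<^sup>2))"
    using assms(2) by (auto simp: gaussian_shaped_def)
  obtain k :: real and K B :: "real^'n^'n" and L :: "real^'n \<Rightarrow> (real^'n) \<times> (real^'n)"
    where k: "0 < k" and L: "linear L" and tilt: "\<And>f r. f \<in> borel_measurable borel \<Longrightarrow>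
      (\<integral>\<^sup>+w. f w * ennreal (exp (- (1/2) * (norm (r - (C ** A) *v w))\<^sup>2)) \<partial>std_gaussian) =
      ennreal (k * exp (- (1/2) * (norm (L r))\<^sup>2)) * (\<integral>\<^sup>+v. f (K *v r + B *v v) \<partial>std_gaussian)"
    using std_gaussian_tilt[of "C ** A"] by blast
  have [measurable]: "h \<in> borel_measurable borel" unfolding h by measurable
  have h_pos: "0 < h x" for x using h by simp
  define m where "m z = \<Phi> *v z + u" for z
  define r where "r z = y - C *v m z" for z
  define E where "E z = c * k * exp (- (1/2) * (norm (L (r z)))\<^sup>2)" for z
  have E_pos: "0 < E z" for z using h(1) k by (simp add: E_def)
  have prior: "gaussian (\<Phi> *v z + u) Q = distr std_gaussian borel (\<lambda>w. m z + A *v w)" for z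
    unfolding A[symmetric] m_def by (rule gaussian_gram)
  \<comment> \<open>The constant \<open>f = 1\<close> will give \<open>H\<close>; multiples of
    indicators will give the posterior measure.\<close>
  have integral: "(\<integral>\<^sup>+x. f x * ennreal (h x) \<partial>gaussian (\<Phi> *v z + u) Q) =
      ennreal (E z) * (\<integral>\<^sup>+v. f (m z + A *v (K *v r z + B *v v)) \<partial>std_gaussian)"
    if [measurable]: "f \<in> borel_measurable borel" for f z
  proof -
    have hw: "h (m z + A *v w) = c * exp (- (1/2) * (norm (r z - (C ** A) *v w))\<^sup>2)" for w
      by (simp add: h r_def matrix_vector_right_distrib matrix_vector_mul_assoc diff_diff_eq)
    have "(\<integral>\<^sup>+x. f x * ennreal (h x) \<partial>gaussian (\<Phi> *v z + u) Q) =
        (\<integral>\<^sup>+w. f (m z + A *v w) * ennreal (h (m z + A *v w)) \<partial>std_gaussian)"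
      unfolding prior by (rule nn_integral_distr) measurable
    also have "\<dots> = (\<integral>\<^sup>+w. ennreal c * (f (m z + A *v w) *
        ennreal (exp (- (1/2) * (norm (r z - (C ** A) *v w))\<^sup>2))) \<partial>std_gaussian)"
      unfolding hw using h(1) by (simp add: ennreal_mult' mult_ac)
    also have "\<dots> = ennreal c * (\<integral>\<^sup>+w. f (m z + A *v w) *
        ennreal (exp (- (1/2) * (norm (r z - (C ** A) *v w))\<^sup>2)) \<partial>std_gaussian)"
      by (rule nn_integral_cmult) measurable
    also have "(\<integral>\<^sup>+w. f (m z + A *v w) *
        ennreal (exp (- (1/2) * (norm (r z - (C ** A) *v w))\<^sup>2)) \<partial>std_gaussian) =
        ennreal (k * exp (- (1/2) * (norm (L (r z)))\<^sup>2)) *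
        (\<integral>\<^sup>+v. f (m z + A *v (K *v r z + B *v v)) \<partial>std_gaussian)"
      by (rule tilt) measurable
    finally show ?thesis using h(1) k by (simp add: E_def ennreal_mult' mult_ac)
  qed
  have H_eq: "H z = E z" for z
  proof -
    interpret prob_space "std_gaussian :: (real^'n) measure" by (rule prob_space_std_gaussian)
    have "(\<integral>\<^sup>+x. ennreal (h x) \<partial>gaussian (\<Phi> *v z + u) Q) = ennreal (E z)"
      using integral[of "\<lambda>_. 1" z] emeasure_space_1 by simp
    then show ?thesis
      \<comment> \<open>\<open>H\<close> is a Bochner integral; positivity of \<open>h\<close>
        allows it to be read off from the nonnegative integral.\<close>
      unfolding H_def using E_pos h_pos
      by (subst integral_eq_nn_integral) (auto simp: less_imp_le prior)
  qed
  define l where "l z = L (C *v (\<Phi> *v z))" for z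
  have "linear l"
    unfolding l_def using L by (intro linearI)
      (simp_all add: matrix_vector_right_distrib matrix_vector_mult_scaleR linear_add linear_scale)
  moreover have "L (r z) = L (y - C *v u) - l z" for z
    using L by (simp add: r_def m_def l_def matrix_vector_right_distrib linear_diff[symmetric] algebra_simps)
  then have "H = (\<lambda>z. (c * k) * exp (- (1/2) * (norm (L (y - C *v u) - l z))\<^sup>2))"
    by (simp add: H_eq E_def fun_eq_iff)
  ultimately show "gaussian_shaped H"
    using gaussian_shaped_least_squares[of "c * k" l "L (y - C *v u)"] h(1) k by simp
  \<comment> \<open>Insert \<open>r z = y - C *v m z\<close> into
    \<open>m z + A *v (K *v r z)\<close> and collect the terms in \<open>z\<close>;
    \<open>A ** K\<close> acts as the Kalman gain.\<close>
  define \<Phi>' where "\<Phi>' = \<Phi> - A ** K ** C ** \<Phi>"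
  define u' where "u' = u + (A ** K) *v (y - C *v u)"
  have mean: "m z + A *v (K *v r z + B *v v) = (\<Phi>' *v z + u') + (A ** B) *v v" for z v
    by (simp add: \<Phi>'_def u'_def m_def r_def matrix_vector_right_distrib matrix_vector_mult_diff_distrib
        matrix_vector_mult_diff_rdistrib matrix_vector_mul_assoc[symmetric] algebra_simps)
  have "density (gaussian (\<Phi> *v z + u) Q) (\<lambda>x. ennreal (h x / H z)) =
      gaussian (\<Phi>' *v z + u') ((A ** B) ** transpose (A ** B))" (is "?P = ?G") for z
  proof (rule measure_eqI)
    show "sets ?P = sets ?G" by (simp add: prior gaussian_gram)
    fix X assume "X \<in> sets ?P"
    then have [measurable]: "X \<in> sets borel" by (simp add: prior)
    have "emeasure ?P X = (\<integral>\<^sup>+x. ennreal (h x / H z) * indicator X x \<partial>gaussian (\<Phi> *v z + u) Q)"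
      by (rule emeasure_density) (simp_all add: prior)
    also have "\<dots> = (\<integral>\<^sup>+x. (ennreal (1 / E z) * indicator X x) * ennreal (h x) \<partial>gaussian (\<Phi> *v z + u) Q)"
    proof (rule nn_integral_cong)
      show "ennreal (h x / H z) * indicator X x = (ennreal (1 / E z) * indicator X x) * ennreal (h x)" for x
        using ennreal_mult'[of "1 / E z" "h x"] E_pos[of z] h_pos[of x] by (simp add: H_eq mult_ac less_imp_le)
    qed
    also have "\<dots> = ennreal (E z) * (\<integral>\<^sup>+v. ennreal (1 / E z) *
        indicator X ((\<Phi>' *v z + u') + (A ** B) *v v) \<partial>std_gaussian)"
      by (subst integral) (simp_all add: mean)
    also have "\<dots> = ennreal (E z) * ennreal (1 / E z) *
        (\<integral>\<^sup>+v. indicator X ((\<Phi>' *v z + u') + (A ** B) *v v) \<partial>std_gaussian)"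
      by (simp add: nn_integral_cmult mult.assoc)
    also have "ennreal (E z) * ennreal (1 / E z) = 1"
      using E_pos[of z] by (simp add: ennreal_mult[symmetric])
    also have "(\<integral>\<^sup>+v. indicator X ((\<Phi>' *v z + u') + (A ** B) *v v) \<partial>std_gaussian) =
        (\<integral>\<^sup>+x. indicator X x \<partial>distr std_gaussian borel (\<lambda>v. (\<Phi>' *v z + u') + (A ** B) *v v))"
      by (rule nn_integral_distr[symmetric]) measurable
    also have "\<dots> = emeasure ?G X" by (simp add: gaussian_gram)
    finally show "emeasure ?P X = emeasure ?G X" by simp
  qed
  then show "\<exists>(\<Phi>'::real^'n^'n) u' (Q'::real^'n^'n). psd_matrix Q' \<and>
      (\<forall>z. density (gaussian (\<Phi> *v z + u) Q) (\<lambda>x. ennreal (h x / H z)) = gaussian (\<Phi>' *v z + u') Q')"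
    using psd_matrix_gram by blast
qed

section \<open>Backward induction and conclusion\<close>

lemma lik_gaussian_shaped:
  fixes M :: "('n::finite, 'm::finite) gm_model"
  assumes "gauss_markov M" "\<forall>t\<in>{1..horizon M}. pd_matrix (meas_cov M t)" "t \<in> {1..horizon M}"
  shows "gaussian_shaped (lik M y t t)"
proof -
  \<comment> \<open>The premise \<open>1 \<le> t\<close> stays inside the induction formula, since
    the hypotheses on the measurement covariances start at time \<open>1\<close>.\<close>
  have "1 \<le> t \<longrightarrow> gaussian_shaped (lik M y t t)"
    if "t \<le> horizon M" for t
    using that
  proof (induction rule: inc_induct)
    case base
    have "lik M y (horizon M) (horizon M) = meas_lik M y (horizon M)"
      by (rule ext) (simp add: lik.simps)
    then show ?case using assms(2) meas_lik_gaussian_shaped[of M "horizon M" y] by auto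
  next
    case (step t)
    show ?case
    proof
      assume t: "1 \<le> t"
      have "gaussian_shaped (lik M y (Suc t) (Suc t))" "psd_matrix (trans_cov M (Suc t))"
        using step assms(1) by (auto simp: gauss_markov_def)
      then have "gaussian_shaped (\<lambda>x. \<integral>x'. lik M y (Suc t) (Suc t) x' \<partial>transition M (Suc t) x)"
        unfolding transition_def by (intro gaussian_conditioning(1))
      moreover have "lik M y (Suc t) t = (\<lambda>x. \<integral>x'. lik M y (Suc t) (Suc t) x' \<partial>transition M (Suc t) x)"
        by (rule ext) (subst lik.simps, simp)
      moreover have "lik M y t t = (\<lambda>x. meas_lik M y t x * lik M y (Suc t) t x)"
        using step by (intro ext) (subst lik.simps, simp)
      moreover have "gaussian_shaped (meas_lik M y t)"
        using t step assms(2) by (intro meas_lik_gaussian_shaped) auto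
      ultimately show "gaussian_shaped (lik M y t t)" by (simp add: gaussian_shaped_mult)
    qed
  qed
  then show ?thesis using assms(3) by auto
qed

theorem theorem2:
  fixes M :: "('n::finite, 'm::finite) gm_model"
    and y :: "nat \<Rightarrow> real^'m"
  assumes "gauss_markov M"
    and "\<forall>t\<in>{1..horizon M}. pd_matrix (meas_cov M t)"
  shows "\<forall>t\<in>{1..horizon M}.
    (\<exists>(\<Phi>::real^'n^'n) (u::real^'n) (Q::real^'n^'n).
       psd_matrix Q \<and> (\<forall>z. posterior_transition M y t z = gaussian (\<Phi> *v z + u) Q)) \<and>
    (\<forall>s\<in>{t - 1, t}.
       \<exists>(k::nat) (c::real) (y'::nat \<Rightarrow> real) (C'::nat \<Rightarrow> real^'n).
         CARD('m) \<le> k \<and> k \<le> CARD('n) \<and> 0 < c \<and>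
         (\<forall>x. lik M y t s x = c * exp (- (1/2) * (\<Sum>i<k. (y' i - C' i \<bullet> x)\<^sup>2))))"
proof (intro ballI conjI)
  fix t assume t: "t \<in> {1..horizon M}"
  have psd: "psd_matrix (trans_cov M t)" and card: "CARD('m) \<le> CARD('n)"
    using assms(1) t by (auto simp: gauss_markov_def)
  note shaped = lik_gaussian_shaped[OF assms t]
  \<comment> \<open>As \<open>1 \<le> t\<close>, the difference \<open>t - 1\<close> is a true
    predecessor and the integral branch of \<open>lik\<close> applies.\<close>
  have pred: "lik M y t (t - 1) =
      (\<lambda>z. \<integral>x. lik M y t t x \<partial>gaussian (trans_mat M t *v z + trans_shift M t) (trans_cov M t))"
    using t by (intro ext) (subst lik.simps, auto simp: transition_def)
  note conditioning = gaussian_conditioning[OF psd shaped, of "trans_mat M t" "trans_shift M t"]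
  show "\<exists>(\<Phi>::real^'n^'n) u (Q::real^'n^'n).
      psd_matrix Q \<and> (\<forall>z. posterior_transition M y t z = gaussian (\<Phi> *v z + u) Q)"
    unfolding posterior_transition_def pred transition_def by (rule conditioning(2))
  fix s assume "s \<in> {t - 1, t}"
  then have "gaussian_shaped (lik M y t s)"
    using shaped conditioning(1) pred by auto
  \<comment> \<open>The witness is \<open>k = CARD('n)\<close> for both values of \<open>s\<close>;
    the lower bound is then \<open>CARD('m) \<le> CARD('n)\<close>.\<close>
  from gaussian_shaped_coordinates[OF this] card
  show "\<exists>(k::nat) (c::real) (y'::nat \<Rightarrow> real) (C'::nat \<Rightarrow> real^'n).
         CARD('m) \<le> k \<and> k \<le> CARD('n) \<and> 0 < c \<and>
         (\<forall>x. lik M y t s x = c * exp (- (1/2) * (\<Sum>i<k. (y' i - C' i \<bullet> x)\<^sup>2)))"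
    by blast
qed

end
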